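(* Let $\gamma\in[0,1]$ and let $C\in\mathcal{C}$ be a bivariate copula. Then $C\in\mathcal{L}_\gamma$ if and only if $\eta(C)\geq\gamma$.
   Context: $\mathcal{C}$ is the class of all bivariate copulas (joint distribution functions on $[0,1]^2$ with uniform marginals). $\mathcal{G}$ is the class of all probability distribution functions on $\mathbb{R}$ that are continuous and strictly increasing in the domain where they are positive and smaller than one. Random variables $X_1,X_2$ on a common probability space with distribution functions $G_1,G_2$ have connecting copula $C\in\mathcal{C}$ if their joint distribution function is $F(x_1,x_2)=C(G_1(x_1),G_2(x_2))$. For $G_1,G_2\in\mathcal{G}$ and $C\in\mathcal{C}$, $\eta(C,G_1,G_2):=\mathbb{P}(X_1\leq X_2)$, where $X_1,X_2$ have distribution functions $G_1,G_2$ respectively and connecting copula $C$. For $G\in\mathcal{G}$ the value $\eta(C,G,G)$ does not depend on $G$; it is denoted $\eta(C):=\eta(C,G,G)$, and it equals $\int_{A\cap[0,1]^2}dC$ with $A=\{(x_1,x_2)\in\mathbb{R}^2: x_1\leq x_2\}$. The usual stochastic order is: $G_1\preceq_{st}G_2$ iff $G_1(t)\geq G_2(t)$ for all $t\in\mathbb{R}$. For $\gamma\in[0,1]$, $\mathcal{L}_\gamma$ is the class of all copulas $C\in\mathcal{C}$ such that $\eta(C,G_1,G_2)\geq\gamma$ for all $G_1,G_2\in\mathcal{G}$ with $G_1\preceq_{st}G_2$. *)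

theory Defs
  imports "HOL-Probability.Probability"
begin

(* A copula is a function on the unit square; its values outside the square are irrelevant. *)
definition is_copula :: "(real \<Rightarrow> real \<Rightarrow> real) \<Rightarrow> bool" where
  "is_copula C \<longleftrightarrow>
     (\<exists>M :: (real \<times> real) measure.
        prob_space M \<and> sets M = sets borel \<and>
        distr M borel fst = uniform_measure lborel {0..1} \<and>
        distr M borel snd = uniform_measure lborel {0..1} \<and>
        (\<forall>u\<in>{0..1}. \<forall>v\<in>{0..1}. C u v = measure M ({..u} \<times> {..v})))"

(* Continuity is required on the whole line: only strict increase is restricted to the
   region where G is positive and smaller than one.  In particular there are no atoms. *)
definition dfs :: "(real \<Rightarrow> real) set" where
  "dfs = {G. (\<exists>M. real_distribution M \<and> G = cdf M) \<and>
             continuous_on UNIV G \<and>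
             strict_mono_on {x. 0 < G x \<and> G x < 1} G}"

definition connecting_copula ::
  "'a measure \<Rightarrow> ('a \<Rightarrow> real) \<Rightarrow> ('a \<Rightarrow> real) \<Rightarrow>
   (real \<Rightarrow> real \<Rightarrow> real) \<Rightarrow> (real \<Rightarrow> real) \<Rightarrow> (real \<Rightarrow> real) \<Rightarrow> bool" where
  "connecting_copula M X1 X2 C G1 G2 \<longleftrightarrow>
     prob_space M \<and> X1 \<in> borel_measurable M \<and> X2 \<in> borel_measurable M \<and>
     cdf (distr M borel X1) = G1 \<and> cdf (distr M borel X2) = G2 \<and>
     (\<forall>x1 x2. measure M {\<omega> \<in> space M. X1 \<omega> \<le> x1 \<and> X2 \<omega> \<le> x2} = C (G1 x1) (G2 x2))"

(* The probability of X1 <= X2 depends only on the joint law of (X1, X2), which is determined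
   by its distribution function; so the value is unique, and restricting the sample space to
   the type real * real loses no generality. *)
definition eta :: "(real \<Rightarrow> real \<Rightarrow> real) \<Rightarrow> (real \<Rightarrow> real) \<Rightarrow> (real \<Rightarrow> real) \<Rightarrow> real" where
  "eta C G1 G2 =
     (THE p. \<exists>(M :: (real \<times> real) measure) X1 X2.
        connecting_copula M X1 X2 C G1 G2 \<and>
        p = measure M {\<omega> \<in> space M. X1 \<omega> \<le> X2 \<omega>})"

(* The common value of eta C G G over all G in dfs. *)
definition eta_diag :: "(real \<Rightarrow> real \<Rightarrow> real) \<Rightarrow> real" where
  "eta_diag C = (THE p. \<forall>G\<in>dfs. eta C G G = p)"

definition st_le :: "(real \<Rightarrow> real) \<Rightarrow> (real \<Rightarrow> real) \<Rightarrow> bool" where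
  "st_le G1 G2 \<longleftrightarrow> (\<forall>t. G1 t \<ge> G2 t)"

definition copula_class :: "real \<Rightarrow> (real \<Rightarrow> real \<Rightarrow> real) set" where
  "copula_class \<gamma> =
     {C. is_copula C \<and> (\<forall>G1\<in>dfs. \<forall>G2\<in>dfs. st_le G1 G2 \<longrightarrow> eta C G1 G2 \<ge> \<gamma>)}"

end

theory Submission
  imports Defs
begin

text \<open>
  Let \<open>(U, V)\<close> be distributed according to the copula \<open>C\<close>, and let \<open>Q\<^sub>1\<close>, \<open>Q\<^sub>2\<close> be the quantile
  functions of \<open>G\<^sub>1\<close>, \<open>G\<^sub>2\<close>.  The pair \<open>(Q\<^sub>1 U, Q\<^sub>2 V)\<close> has marginals \<open>G\<^sub>1\<close>, \<open>G\<^sub>2\<close> and connecting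
  copula \<open>C\<close>, and a joint distribution function determines the joint law, so
  \<open>\<eta>(C, G\<^sub>1, G\<^sub>2) = \<P>(Q\<^sub>1 U \<le> Q\<^sub>2 V)\<close> (lemma \<open>eta_eq\<close>).  This puts all pairs \<open>G\<^sub>1, G\<^sub>2\<close> on one probability
  space, where they can be compared pointwise.

  The quantile function of a continuous \<open>G\<close> is strictly increasing, so \<open>Q U \<le> Q V\<close> is the event
  \<open>U \<le> V\<close>; hence \<open>\<eta>(C) = \<P>(U \<le> V)\<close>, whatever \<open>G\<close> is.  If \<open>G\<^sub>1\<close> is stochastically smaller than \<open>G\<^sub>2\<close>,
  then \<open>Q\<^sub>1 \<le> Q\<^sub>2\<close>, so \<open>U \<le> V\<close> implies \<open>Q\<^sub>1 U \<le> Q\<^sub>1 V \<le> Q\<^sub>2 V\<close>; thus \<open>\<eta>(C, G\<^sub>1, G\<^sub>2) \<ge> \<eta>(C)\<close>, with equality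
  for \<open>G\<^sub>1 = G\<^sub>2\<close>.  The infimum that defines the class is therefore attained on the diagonal and equals
  \<open>\<eta>(C)\<close>.
\<close>

text \<open>The lower left quadrants form an intersection-stable generator of the Borel sets of the plane.\<close>

lemma prob_eqI_quadrants:
  fixes M N :: "(real \<times> real) measure"
  assumes "prob_space M" "prob_space N" "sets M = sets borel" "sets N = sets borel"
    and eq: "\<And>x y. measure M ({..x} \<times> {..y}) = measure N ({..x} \<times> {..y})"
  shows "M = N"
proof -
  interpret M: prob_space M by fact
  interpret N: prob_space N by fact
  define E where "E = range (\<lambda>a :: real \<times> real. {..a})"
  have quadrant: "{..a} = {..fst a} \<times> {..snd a}" for a :: "real \<times> real"
    by (auto simp: less_eq_prod_def)
  have borel: "sets borel = sigma_sets UNIV E"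
    unfolding borel_eq_atMost E_def by simp
  show ?thesis
  proof (rule measure_eqI_generator_eq[where E = E and \<Omega> = UNIV
        and A = "\<lambda>n::nat. {..(real n, real n)}"])
    show "Int_stable E"
    proof (rule Int_stableI)
      fix a b assume "a \<in> E" "b \<in> E"
      then obtain x y where xy: "a = {..x}" "b = {..y}"
        by (auto simp: E_def)
      have "a \<inter> b = {..(min (fst x) (fst y), min (snd x) (snd y))}"
        by (auto simp: xy less_eq_prod_def)
      then show "a \<inter> b \<in> E"
        by (simp add: E_def)
    qed
    show "emeasure M X = emeasure N X" if "X \<in> E" for X
      using that eq by (auto simp: E_def quadrant M.emeasure_eq_measure N.emeasure_eq_measure)
    show "sets M = sigma_sets UNIV E" "sets N = sigma_sets UNIV E"
      using assms borel by simp_all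
    show "range (\<lambda>n::nat. {..(real n, real n)}) \<subseteq> E"
      by (auto simp: E_def)
    show "(\<Union>n::nat. {..(real n, real n)}) = UNIV"
    proof (intro equalityI subsetI UNIV_I)
      fix p :: "real \<times> real"
      obtain n :: nat where "max (fst p) (snd p) \<le> real n"
        using real_arch_simple by blast
      then show "p \<in> (\<Union>n::nat. {..(real n, real n)})"
        by (auto simp: less_eq_prod_def)
    qed
  qed (auto simp: M.emeasure_eq_measure)
qed

section \<open>Quantile functions\<close>

text \<open>
  The infimum is meaningful on the open unit interval only, where it satisfies the Galois connection
  \<open>quantile_le_iff\<close>.  A uniform variable stays there almost surely; the constant value
  elsewhere makes it evident that the function is Borel measurable on the whole line.
\<close>

definition quantile :: "(real \<Rightarrow> real) \<Rightarrow> real \<Rightarrow> real" where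
  "quantile G u = (if u \<in> {0<..<1} then Inf {x. u \<le> G x} else 0)"

lemma quantile_le_iff:
  assumes "real_distribution M" "u \<in> {0<..<1}"
  shows "quantile (cdf M) u \<le> x \<longleftrightarrow> u \<le> cdf M x"
proof -
  interpret cdf_distribution M
    using assms(1) by (simp add: cdf_distribution_def)
  show ?thesis
    using pseudoinverse[of u x] assms(2) by (simp add: quantile_def)
qed

lemma quantile_measurable:
  assumes "real_distribution M"
  shows "quantile (cdf M) \<in> borel_measurable borel"
proof -
  interpret cdf_distribution M
    using assms(1) by (simp add: cdf_distribution_def)
  have "(\<lambda>u. if u \<in> {0<..<1} then I u else 0) \<in> borel_measurable borel"
    by (subst measurable_If_restrict_space_iff) (simp_all del: greaterThanLessThan_iff)
  then show ?thesis
    unfolding quantile_def[abs_def] .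
qed

text \<open>
  By the Galois connection, the larger distribution function reaches every level first.  This is
  the coupling form of the stochastic order.
\<close>

lemma quantile_mono:
  assumes "real_distribution M1" "real_distribution M2" "st_le (cdf M1) (cdf M2)"
    and "u \<in> {0<..<1}" "v \<in> {0<..<1}" "u \<le> v"
  shows "quantile (cdf M1) u \<le> quantile (cdf M2) v"
proof -
  have "v \<le> cdf M2 (quantile (cdf M2) v)"
    using assms quantile_le_iff by blast
  also have "\<dots> \<le> cdf M1 (quantile (cdf M2) v)"
    using assms(3) by (simp add: st_le_def)
  finally show ?thesis
    using assms by (simp add: quantile_le_iff)
qed

text \<open>
  At the \<open>u\<close>-quantile a distribution function is at least \<open>u\<close>; without a jump there it cannot exceed
  \<open>u\<close>, since it stays below \<open>u\<close> to the left.
\<close>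

lemma cdf_quantile:
  assumes M: "real_distribution M" and u: "u \<in> {0<..<1}"
    and cont: "isCont (cdf M) (quantile (cdf M) u)"
  shows "cdf M (quantile (cdf M) u) = u"
proof (rule antisym)
  let ?q = "quantile (cdf M) u"
  show "u \<le> cdf M ?q"
    using quantile_le_iff[OF M u] by blast
  have "(cdf M \<longlongrightarrow> cdf M ?q) (at_left ?q)"
    using cont by (simp add: isCont_def filterlim_at_split)
  moreover have "eventually (\<lambda>x. cdf M x \<le> u) (at_left ?q)"
    using quantile_le_iff[OF M u] unfolding eventually_at_filter
    by (intro always_eventually) (metis lessThan_iff linear not_le)
  ultimately show "cdf M ?q \<le> u"
    by (rule tendsto_upperbound) simp
qed

lemma quantile_le_quantile_iff:
  assumes M: "real_distribution M" and cont: "continuous_on UNIV (cdf M)"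
    and u: "u \<in> {0<..<1}" and v: "v \<in> {0<..<1}"
  shows "quantile (cdf M) u \<le> quantile (cdf M) v \<longleftrightarrow> u \<le> v"
proof -
  have "isCont (cdf M) x" for x
    using cont by (simp add: continuous_on_eq_continuous_at)
  then show ?thesis
    using quantile_le_iff[OF M u] cdf_quantile[OF M v] by simp
qed

section \<open>The uniform distribution\<close>

abbreviation uniform01 :: "real measure" where
  "uniform01 \<equiv> uniform_measure lborel {0..1}"

lemma real_distribution_uniform01: "real_distribution uniform01"
  by (auto simp: real_distribution_def real_distribution_axioms_def
      intro!: prob_space_uniform_measure)

lemma cdf_uniform01: "cdf uniform01 x = max 0 (min 1 x)"
proof -
  have "{0..1} \<inter> {..x} = {0..min 1 x}"
    by auto
  then show ?thesis
    by (simp add: cdf_def)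
qed

lemma AE_uniform01: "AE u in uniform01. u \<in> {0<..<1}"
proof -
  have "AE u in lborel. u \<noteq> (0::real)" "AE u in lborel. u \<noteq> (1::real)"
    by (rule AE_lborel_singleton)+
  then have "AE u in lborel. u \<in> {0..1} \<longrightarrow> u \<in> {0<..<(1::real)}"
    by eventually_elim auto
  then show ?thesis
    by (intro AE_uniform_measureI) auto
qed

lemma cdf_uniform01_in_dfs: "cdf uniform01 \<in> dfs"
proof -
  have "continuous_on UNIV (cdf uniform01)"
    unfolding cdf_uniform01[abs_def] by (intro continuous_intros)
  moreover have "strict_mono_on {x. 0 < cdf uniform01 x \<and> cdf uniform01 x < 1} (cdf uniform01)"
    by (auto simp: strict_mono_on_def cdf_uniform01 max_def min_def)
  ultimately show ?thesis
    unfolding dfs_def using real_distribution_uniform01 by blast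
qed

section \<open>Realising a copula by quantile transforms\<close>

text \<open>The measure \<open>N\<close> is the joint law of the pair \<open>(U, V)\<close>.\<close>

locale copula_law = prob_space N for N :: "(real \<times> real) measure" +
  fixes C :: "real \<Rightarrow> real \<Rightarrow> real"
  assumes sets_N [simp, measurable_cong]: "sets N = sets borel"
    and fst_uniform: "distr N borel fst = uniform01"
    and snd_uniform: "distr N borel snd = uniform01"
    and C_eq: "u \<in> {0..1} \<Longrightarrow> v \<in> {0..1} \<Longrightarrow> C u v = measure N ({..u} \<times> {..v})"
begin

lemma space_N [simp]: "space N = UNIV"
  using sets_eq_imp_space_eq[OF sets_N] by simp

lemma fst_measurable [measurable]: "fst \<in> borel_measurable N"
  and snd_measurable [measurable]: "snd \<in> borel_measurable N"
  by (simp_all add: measurable_cong_sets[OF sets_N refl] borel_prod[symmetric])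

lemma AE_unit_square: "AE p in N. fst p \<in> {0<..<1} \<and> snd p \<in> {0<..<1}"
proof -
  have "AE p in N. fst p \<in> {0<..<1}"
    using AE_uniform01 unfolding fst_uniform[symmetric] by (subst (asm) AE_distr_iff) auto
  moreover have "AE p in N. snd p \<in> {0<..<1}"
    using AE_uniform01 unfolding snd_uniform[symmetric] by (subst (asm) AE_distr_iff) auto
  ultimately show ?thesis
    by eventually_elim auto
qed

lemma cdf_distr_quantile:
  assumes X: "X \<in> borel_measurable N" and unif: "distr N borel X = uniform01"
    and M: "real_distribution M"
  shows "cdf (distr N borel (\<lambda>p. quantile (cdf M) (X p))) = cdf M"
proof
  fix x
  note [measurable] = X quantile_measurable[OF M]
  interpret M: real_distribution M by fact
  have "AE p in N. X p \<in> {0<..<1}"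
    using AE_uniform01 unfolding unif[symmetric] by (subst (asm) AE_distr_iff) auto
  then have ae: "AE p in N. quantile (cdf M) (X p) \<le> x \<longleftrightarrow> X p \<le> cdf M x"
    by eventually_elim (simp add: quantile_le_iff[OF M])
  have "cdf (distr N borel (\<lambda>p. quantile (cdf M) (X p))) x
      = measure N {p \<in> space N. quantile (cdf M) (X p) \<le> x}"
    unfolding cdf_def[of "distr N borel _"] by (subst measure_distr) (auto intro!: arg_cong[where f = "measure N"])
  also have "\<dots> = measure N {p \<in> space N. X p \<le> cdf M x}"
    using ae by (intro measure_eq_AE) auto
  also have "\<dots> = cdf (distr N borel X) (cdf M x)"
    unfolding cdf_def[of "distr N borel _"] by (subst measure_distr) (auto intro!: arg_cong[where f = "measure N"])
  also have "\<dots> = cdf M x"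
    using M.cdf_nonneg[of x] M.cdf_bounded_prob[of x] by (simp add: unif cdf_uniform01)
  finally show "cdf (distr N borel (\<lambda>p. quantile (cdf M) (X p))) x = cdf M x" .
qed

text \<open>
  By the Galois connection, the event \<open>Q\<^sub>1 U \<le> x \<and> Q\<^sub>2 V \<le> y\<close> is almost surely
  \<open>U \<le> G\<^sub>1 x \<and> V \<le> G\<^sub>2 y\<close>, whose probability is a value of the copula.
\<close>

lemma connecting_copula_quantile:
  assumes M1: "real_distribution M1" and M2: "real_distribution M2"
  shows "connecting_copula N (\<lambda>p. quantile (cdf M1) (fst p)) (\<lambda>p. quantile (cdf M2) (snd p))
    C (cdf M1) (cdf M2)"
proof -
  interpret M1: real_distribution M1 by fact
  interpret M2: real_distribution M2 by fact
  note [measurable] = quantile_measurable[OF M1] quantile_measurable[OF M2]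
  have joint: "measure N {p \<in> space N. quantile (cdf M1) (fst p) \<le> x \<and> quantile (cdf M2) (snd p) \<le> y}
      = C (cdf M1 x) (cdf M2 y)" for x y
  proof -
    have "AE p in N. quantile (cdf M1) (fst p) \<le> x \<and> quantile (cdf M2) (snd p) \<le> y
        \<longleftrightarrow> fst p \<le> cdf M1 x \<and> snd p \<le> cdf M2 y"
      using AE_unit_square
      by eventually_elim (simp add: quantile_le_iff[OF M1] quantile_le_iff[OF M2])
    then have "measure N {p \<in> space N. quantile (cdf M1) (fst p) \<le> x \<and> quantile (cdf M2) (snd p) \<le> y}
        = measure N {p \<in> space N. fst p \<le> cdf M1 x \<and> snd p \<le> cdf M2 y}"
      by (intro measure_eq_AE) auto
    also have "\<dots> = measure N ({..cdf M1 x} \<times> {..cdf M2 y})"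
      by (auto intro!: arg_cong[where f = "measure N"])
    also have "\<dots> = C (cdf M1 x) (cdf M2 y)"
      using M1.cdf_nonneg M1.cdf_bounded_prob M2.cdf_nonneg M2.cdf_bounded_prob by (simp add: C_eq)
    finally show ?thesis .
  qed
  show ?thesis
    unfolding connecting_copula_def
    using joint cdf_distr_quantile[OF fst_measurable fst_uniform M1]
      cdf_distr_quantile[OF snd_measurable snd_uniform M2]
    by (auto simp: prob_space_axioms)
qed

end

lemma copula_law_exists:
  assumes "is_copula C"
  obtains N where "copula_law N C"
  using assms unfolding is_copula_def copula_law_def copula_law_axioms_def by blast

text \<open>
  The joint distribution function determines the joint law, so that the description in the
  definition of \<open>eta\<close> has at most one solution.
\<close>

lemma connecting_copula_prob_unique:
  assumes MX: "connecting_copula M X1 X2 C G1 G2" and NY: "connecting_copula N Y1 Y2 C G1 G2"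
  shows "measure M {\<omega> \<in> space M. X1 \<omega> \<le> X2 \<omega>} = measure N {\<omega> \<in> space N. Y1 \<omega> \<le> Y2 \<omega>}"
proof -
  have law: "prob_space (distr M borel (\<lambda>\<omega>. (X1 \<omega>, X2 \<omega>)))"
    and quadrant: "measure (distr M borel (\<lambda>\<omega>. (X1 \<omega>, X2 \<omega>))) ({..x} \<times> {..y}) = C (G1 x) (G2 y)"
    and diag: "measure (distr M borel (\<lambda>\<omega>. (X1 \<omega>, X2 \<omega>))) {p. fst p \<le> snd p}
      = measure M {\<omega> \<in> space M. X1 \<omega> \<le> X2 \<omega>}"
    if MX: "connecting_copula M X1 X2 C G1 G2" for M :: "'c measure" and X1 X2 x y
  proof -
    interpret prob_space M
      using MX by (simp add: connecting_copula_def)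
    have [measurable]: "X1 \<in> borel_measurable M" "X2 \<in> borel_measurable M"
      using MX by (simp_all add: connecting_copula_def)
    have X: "(\<lambda>\<omega>. (X1 \<omega>, X2 \<omega>)) \<in> borel_measurable M"
      by measurable
    show "prob_space (distr M borel (\<lambda>\<omega>. (X1 \<omega>, X2 \<omega>)))"
      using X by (rule prob_space_distr)
    have "{..x} \<times> {..y} \<in> sets borel"
      by (intro borel_closed closed_Times) auto
    then have "measure (distr M borel (\<lambda>\<omega>. (X1 \<omega>, X2 \<omega>))) ({..x} \<times> {..y})
        = measure M {\<omega> \<in> space M. X1 \<omega> \<le> x \<and> X2 \<omega> \<le> y}"
      by (subst measure_distr[OF X]) (auto intro!: arg_cong[where f = "measure M"])
    then show "measure (distr M borel (\<lambda>\<omega>. (X1 \<omega>, X2 \<omega>))) ({..x} \<times> {..y}) = C (G1 x) (G2 y)"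
      using MX by (simp add: connecting_copula_def)
    have "{p :: real \<times> real. fst p \<le> snd p} \<in> sets borel"
      by (intro borel_closed closed_Collect_le continuous_intros)
    then show "measure (distr M borel (\<lambda>\<omega>. (X1 \<omega>, X2 \<omega>))) {p. fst p \<le> snd p}
        = measure M {\<omega> \<in> space M. X1 \<omega> \<le> X2 \<omega>}"
      by (subst measure_distr[OF X]) (auto intro!: arg_cong[where f = "measure M"])
  qed
  have "distr M borel (\<lambda>\<omega>. (X1 \<omega>, X2 \<omega>)) = distr N borel (\<lambda>\<omega>. (Y1 \<omega>, Y2 \<omega>))"
    using law[OF MX] law[OF NY] quadrant[OF MX] quadrant[OF NY] by (intro prob_eqI_quadrants) auto
  then show ?thesis
    using diag[OF MX] diag[OF NY] by simp
qed

section \<open>The value of \<open>\<eta>\<close>\<close>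

context copula_law
begin

lemma eta_eq:
  assumes "real_distribution M1" "real_distribution M2"
  shows "eta C (cdf M1) (cdf M2)
    = measure N {p \<in> space N. quantile (cdf M1) (fst p) \<le> quantile (cdf M2) (snd p)}"
  unfolding eta_def
  using connecting_copula_quantile[OF assms] connecting_copula_prob_unique
  by (intro the_equality) blast+

lemma eta_same:
  assumes "G \<in> dfs"
  shows "eta C G G = measure N {p \<in> space N. fst p \<le> snd p}"
proof -
  obtain M where M: "real_distribution M" and G: "G = cdf M" and cont: "continuous_on UNIV (cdf M)"
    using assms by (auto simp: dfs_def)
  note [measurable] = quantile_measurable[OF M]
  have "AE p in N. quantile (cdf M) (fst p) \<le> quantile (cdf M) (snd p) \<longleftrightarrow> fst p \<le> snd p"
    using AE_unit_square by eventually_elim (simp add: quantile_le_quantile_iff[OF M cont])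
  then show ?thesis
    unfolding G eta_eq[OF M M] by (intro measure_eq_AE) auto
qed

text \<open>A witness in \<open>dfs\<close> is needed here: over an empty class every number would be a common value.\<close>

lemma eta_diag_eq: "eta_diag C = measure N {p \<in> space N. fst p \<le> snd p}"
  unfolding eta_diag_def using eta_same cdf_uniform01_in_dfs by (intro the_equality) auto

lemma eta_diag_le_eta:
  assumes "G1 \<in> dfs" "G2 \<in> dfs" and le: "st_le G1 G2"
  shows "eta_diag C \<le> eta C G1 G2"
proof -
  obtain M1 M2 where M1: "real_distribution M1" and M2: "real_distribution M2"
    and G: "G1 = cdf M1" "G2 = cdf M2"
    using assms by (auto simp: dfs_def)
  note [measurable] = quantile_measurable[OF M1] quantile_measurable[OF M2]
  have "AE p in N. fst p \<le> snd p \<longrightarrow> quantile (cdf M1) (fst p) \<le> quantile (cdf M2) (snd p)"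
    using AE_unit_square by eventually_elim (use quantile_mono[OF M1 M2] le G in blast)
  then show ?thesis
    unfolding eta_diag_eq G eta_eq[OF M1 M2] by (intro finite_measure_mono_AE) auto
qed

end

theorem theorem5:
  fixes \<gamma> :: real and C :: "real \<Rightarrow> real \<Rightarrow> real"
  assumes "\<gamma> \<in> {0..1}"
    and "is_copula C"
  shows "C \<in> copula_class \<gamma> \<longleftrightarrow> eta_diag C \<ge> \<gamma>"
proof -
  obtain N where "copula_law N C"
    using assms(2) by (rule copula_law_exists)
  then interpret copula_law N C .
  show ?thesis
  proof
    assume "C \<in> copula_class \<gamma>"
    then have "\<gamma> \<le> eta C (cdf uniform01) (cdf uniform01)"
      using cdf_uniform01_in_dfs by (simp add: copula_class_def st_le_def)
    then show "\<gamma> \<le> eta_diag C"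
      by (simp add: eta_same[OF cdf_uniform01_in_dfs] eta_diag_eq)
  next
    assume "\<gamma> \<le> eta_diag C"
    then show "C \<in> copula_class \<gamma>"
      using assms(2) eta_diag_le_eta unfolding copula_class_def by (blast intro: order_trans)
  qed
qed

end
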